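(* For the set of bidders $L$, consider the VCG mechanism (with the Clarke pivot rule) for the reverse auction described in the context. If the objective function $J$ is supermodular, then: (i) A group of bidders who lose when bidding their true values cannot profit by a joint deviation. That is: let $K\subseteq L$, let $\mathcal{C}_K=\{c_l\}_{l\in K}$ be the true costs of the bidders in $K$, and let $\mathcal{C}=(\mathcal{C}_K,\mathcal{C}_{-K})$, where $\mathcal{C}_{-K}$ are the (not necessarily truthful) bids of the other bidders, be such that $x_l^*(\mathcal{C})=0$ for all $l\in K$. Then for all bids $\mathcal{B}_K=\{b_l\}_{l\in K}$, with $\mathcal{B}=(\mathcal{B}_K,\mathcal{C}_{-K})$, one has $\sum_{l\in K}u_l^{\mathrm{VCG}}(\mathcal{B})\le\sum_{l\in K}u_l^{\mathrm{VCG}}(\mathcal{C})=0$. (ii) Bidding with multiple identities is unprofitable for any bidder. That is: let bidder $l\in L$ have true cost $c_l$, let $\mathcal{C}=(\mathcal{C}_{-l},c_l)$, where $\mathcal{C}_{-l}$ are the (not necessarily truthful) bids of the other bidders, and let $\mathcal{B}=(\mathcal{C}_{-l},\mathcal{B}_S)$ be the profile in which bidder $l$ participates instead through a set $S$ of identities with bids $\mathcal{B}_S=\{b_k\}_{k\in S}$. Then the total utility of bidder $l$ from these shill bids satisfies $$\sum_{k\in S}p_k(\mathcal{B})-c_l\Big(\sum_{k\in S}x_k^*(\mathcal{B})\Big)\le u_l^{\mathrm{VCG}}(\mathcal{C}).$$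
   Context: Reverse auction. $L$ is a finite set of bidders, $t$ is the number of types of goods, and $d:\mathbb{R}_+^{t|L|}\times\mathbb{R}^p\to\mathbb{R}$ and $g:\mathbb{R}_+^{t|L|}\times\mathbb{R}^p\to\mathbb{R}^q$ are given functions. Each bidder $l$ has a private true cost $c_l$ and submits a bid $b_l$; true costs and bids are nondecreasing functions $\mathbb{R}_+^t\to\mathbb{R}_+$ vanishing at $0$. For a bid profile $\mathcal{B}=\{b_l\}_{l\in L}$ and $S\subseteq L$, $$J(\mathcal{B}_S)=\min_{x,y}\ \sum_{l\in S}b_l(x_l)+d(x,y)\quad\text{s.t. } g(x,y)\le 0,\ x_l=0\ \ \forall l\in L\setminus S,$$ with $x\in\mathbb{R}_+^{t|L|}$, $y\in\mathbb{R}^p$, and value $\infty$ if the problem is infeasible. Write $J(\mathcal{B})=J(\mathcal{B}_L)$ and $\mathcal{B}_{-l}=\mathcal{B}_{L\setminus\{l\}}$. $(x^*(\mathcal{B}),y^*(\mathcal{B}))$ denotes the optimal solution for $S=L$; in case of multiple optima there is some tie-breaking rule according to a predetermined fixed ordering of the bidders. VCG mechanism with the Clarke pivot rule: the allocation is $x_l^*(\mathcal{B})$ and the payment is $p_l(\mathcal{B})=b_l(x_l^*(\mathcal{B}))+J(\mathcal{B}_{-l})-J(\mathcal{B})$. The mechanism is well defined under the assumption that there is a feasible solution when a bidder is removed. The utility of bidder $l$ is $u_l^{\mathrm{VCG}}(\mathcal{B})=p_l(\mathcal{B})-c_l(x_l^*(\mathcal{B}))$. A bidder with $x_l^*(\mathcal{B})=0$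 loses, is not paid and has utility $0$. Goods of the same type from different bidders are fungible to the central operator, so that $g$ and $d$ in fact depend on $x$ only through $\sum_l x_l$; thus the auction is defined in the same way when bidder $l$ is replaced by several identities. "$J$ is supermodular" means that, under any bid profile $\mathcal{B}$, the set function $f(S)=J(\mathcal{B}_S)$ is supermodular: $f(S)-f(S\setminus\{l\})\le f(R)-f(R\setminus\{l\})$ for all $S\subseteq R\subseteq L$ and $l\in S$, or equivalently $f(S\cup R)+f(S\cap R)\ge f(S)+f(R)$ for all $S,R\subseteq L$.
   Formalization: In (ii), J is also assumed supermodular for the auction in which bidder l is replaced by the identities S (participants (L∖{l})∪S); supermodularity over subsets of L alone does not suffice, e.g. it is vacuous when L={l}. *)

theory Defs
  imports "HOL-Analysis.Analysis"
begin

text \<open>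
  Bidders (and shill identities) are elements of a type \<open>'i\<close>; the participants of an auction form a
  finite set \<open>N\<close>. An allocation is a function \<open>'i \<Rightarrow> real^'t\<close> that vanishes outside the participants,
  so that \<open>d\<close> and \<open>g\<close> make sense for every set of participants. Only the values of a bid on the
  nonnegative orthant \<open>{0..}\<close> matter; the order on \<open>real^'t\<close> and \<open>real^'q\<close> is componentwise.
\<close>

type_synonym 't bid = "real^'t \<Rightarrow> real"

definition valid_bid :: "('t::finite) bid \<Rightarrow> bool" where
  "valid_bid b \<longleftrightarrow> b 0 = 0 \<and> b ` {0..} \<subseteq> {0..} \<and> mono_on {0..} b"

definition allocations :: "'i set \<Rightarrow> ('i \<Rightarrow> real^('t::finite)) set" where
  "allocations N = {x. (\<forall>l. 0 \<le> x l) \<and> (\<forall>l. l \<notin> N \<longrightarrow> x l = 0)}"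

definition fungible ::
  "(('i \<Rightarrow> real^('t::finite)) \<Rightarrow> real^('p::finite) \<Rightarrow> 'c) \<Rightarrow> bool" where
  "fungible h \<longleftrightarrow>
    (\<forall>N x x' y. finite N \<and> x \<in> allocations N \<and> x' \<in> allocations N \<and>
        (\<Sum>l\<in>N. x l) = (\<Sum>l\<in>N. x' l) \<longrightarrow> h x y = h x' y)"

definition feasible ::
  "(('i \<Rightarrow> real^('t::finite)) \<Rightarrow> real^('p::finite) \<Rightarrow> real^('q::finite)) \<Rightarrow> 'i set
    \<Rightarrow> (('i \<Rightarrow> real^'t) \<times> (real^'p)) set" where
  "feasible g S = {(x, y). x \<in> allocations S \<and> g x y \<le> 0}"

definition objective ::
  "(('i \<Rightarrow> real^('t::finite)) \<Rightarrow> real^('p::finite) \<Rightarrow> real) \<Rightarrow> 'i set \<Rightarrow> ('i \<Rightarrow> 't bid)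
    \<Rightarrow> ('i \<Rightarrow> real^'t) \<times> (real^'p) \<Rightarrow> real" where
  "objective d S b = (\<lambda>(x, y). (\<Sum>l\<in>S. b l (x l)) + d x y)"

definition optimal ::
  "(('i \<Rightarrow> real^('t::finite)) \<Rightarrow> real^('p::finite) \<Rightarrow> real)
    \<Rightarrow> (('i \<Rightarrow> real^'t) \<Rightarrow> real^'p \<Rightarrow> real^('q::finite))
    \<Rightarrow> 'i set \<Rightarrow> ('i \<Rightarrow> 't bid) \<Rightarrow> ('i \<Rightarrow> real^'t) \<times> (real^'p) \<Rightarrow> bool" where
  "optimal d g S b z \<longleftrightarrow> is_arg_min (objective d S b) (\<lambda>z. z \<in> feasible g S) z"

text \<open>
  \<open>J d g S b\<close> is the optimal value for the bids \<open>b\<close> restricted to \<open>S\<close>. The infimum over the empty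
  set is \<open>\<infinity>\<close>; for bid profiles as defined below it is a minimum in every feasible case.
\<close>

definition J ::
  "(('i \<Rightarrow> real^('t::finite)) \<Rightarrow> real^('p::finite) \<Rightarrow> real)
    \<Rightarrow> (('i \<Rightarrow> real^'t) \<Rightarrow> real^'p \<Rightarrow> real^('q::finite))
    \<Rightarrow> 'i set \<Rightarrow> ('i \<Rightarrow> 't bid) \<Rightarrow> ereal" where
  "J d g S b = (INF z \<in> feasible g S. ereal (objective d S b z))"

text \<open>
  The second conjunct makes explicit that \<open>J\<close> is defined by a minimum: nondecreasing bids need not
  be lower semicontinuous, so attainment does not follow from the first conjunct.
\<close>

definition bid_profile ::
  "(('i \<Rightarrow> real^('t::finite)) \<Rightarrow> real^('p::finite) \<Rightarrow> real)
    \<Rightarrow> (('i \<Rightarrow> real^'t) \<Rightarrow> real^'p \<Rightarrow> real^('q::finite))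
    \<Rightarrow> 'i set \<Rightarrow> ('i \<Rightarrow> 't bid) \<Rightarrow> bool" where
  "bid_profile d g N b \<longleftrightarrow>
    (\<forall>l\<in>N. valid_bid (b l)) \<and>
    (\<forall>S\<subseteq>N. feasible g S \<noteq> {} \<longrightarrow> (\<exists>z. optimal d g S b z))"

text \<open>
  Supermodularity is stated in its additive form, which needs no difference \<open>\<infinity> - \<infinity>\<close>.
\<close>

definition J_supermodular ::
  "(('i \<Rightarrow> real^('t::finite)) \<Rightarrow> real^('p::finite) \<Rightarrow> real)
    \<Rightarrow> (('i \<Rightarrow> real^'t) \<Rightarrow> real^'p \<Rightarrow> real^('q::finite)) \<Rightarrow> 'i set \<Rightarrow> bool" where
  "J_supermodular d g N \<longleftrightarrow>
    (\<forall>b. bid_profile d g N b \<longrightarrow>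
      (\<forall>S R. S \<subseteq> N \<and> R \<subseteq> N \<longrightarrow>
        J d g (S \<union> R) b + J d g (S \<inter> R) b \<ge> J d g S b + J d g R b))"

text \<open>
  A solution rule picks an optimal solution for each set of participants and each profile, whenever
  one exists. Any way of breaking ties, in particular by a fixed ordering of the bidders, is allowed.
\<close>

type_synonym ('i, 't, 'p) solution_rule =
  "'i set \<Rightarrow> ('i \<Rightarrow> 't bid) \<Rightarrow> ('i \<Rightarrow> real^'t) \<times> (real^'p)"

definition solution_rule ::
  "(('i \<Rightarrow> real^('t::finite)) \<Rightarrow> real^('p::finite) \<Rightarrow> real)
    \<Rightarrow> (('i \<Rightarrow> real^'t) \<Rightarrow> real^'p \<Rightarrow> real^('q::finite))
    \<Rightarrow> ('i, 't, 'p) solution_rule \<Rightarrow> bool" where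
  "solution_rule d g sol \<longleftrightarrow>
    (\<forall>N b. (\<exists>z. optimal d g N b z) \<longrightarrow> optimal d g N b (sol N b))"

definition allocation ::
  "('i, 't::finite, 'p::finite) solution_rule \<Rightarrow> 'i set \<Rightarrow> ('i \<Rightarrow> 't bid) \<Rightarrow> 'i \<Rightarrow> real^'t" where
  "allocation sol N b l = fst (sol N b) l"

text \<open>
  A bidder \<open>l\<close> with zero allocation gets payment and utility \<open>0\<close> from the formulas below, because
  then \<open>J d g (N - {l}) b = J d g N b\<close>.
\<close>

definition payment ::
  "(('i \<Rightarrow> real^('t::finite)) \<Rightarrow> real^('p::finite) \<Rightarrow> real)
    \<Rightarrow> (('i \<Rightarrow> real^'t) \<Rightarrow> real^'p \<Rightarrow> real^('q::finite))
    \<Rightarrow> ('i, 't, 'p) solution_rule \<Rightarrow> 'i set \<Rightarrow> ('i \<Rightarrow> 't bid) \<Rightarrow> 'i \<Rightarrow> ereal" where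
  "payment d g sol N b l =
    ereal (b l (allocation sol N b l)) + J d g (N - {l}) b - J d g N b"

definition utility ::
  "(('i \<Rightarrow> real^('t::finite)) \<Rightarrow> real^('p::finite) \<Rightarrow> real)
    \<Rightarrow> (('i \<Rightarrow> real^'t) \<Rightarrow> real^'p \<Rightarrow> real^('q::finite))
    \<Rightarrow> ('i, 't, 'p) solution_rule \<Rightarrow> 'i set \<Rightarrow> ('i \<Rightarrow> 't bid) \<Rightarrow> ('i \<Rightarrow> 't bid) \<Rightarrow> 'i \<Rightarrow> ereal" where
  "utility d g sol N c b l =
    payment d g sol N b l - ereal (c l (allocation sol N b l))"

end

theory Submission
  imports Defs
begin

text \<open>
  Writing \<open>J\<close> for the optimal value, supermodularity makes the sum of the marginal contributions
  \<open>J(N - {k}) - J(N)\<close> over a coalition \<open>K\<close> at most the joint contribution \<open>J(N - K) - J(N)\<close>. Hence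
  the total payment of \<open>K\<close> is at most what one bidder holding all of \<open>K\<close> would be paid, and both
  claims reduce to the fact that the VCG mechanism is truthful for a single bidder: the allocation
  obtained by deviating is a candidate in the minimisation defining \<open>J(C)\<close>. For shill bids this
  candidate hands the goods of all identities to the bidder, which fungibility permits.
\<close>

section \<open>Feasible sets and the optimal value: monotonicity, attainment, finiteness\<close>

lemma allocations_mono: "S \<subseteq> T \<Longrightarrow> allocations S \<subseteq> allocations T"
  unfolding allocations_def by auto

lemma feasible_mono: "S \<subseteq> T \<Longrightarrow> feasible g S \<subseteq> feasible g T"
  using allocations_mono unfolding feasible_def by fastforce

lemma J_le: "z \<in> feasible g S \<Longrightarrow> J d g S b \<le> ereal (objective d S b z)"
  unfolding J_def by (rule INF_lower)

lemma optimal_feasible: "optimal d g S b z \<Longrightarrow> z \<in> feasible g S"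
  unfolding optimal_def is_arg_min_def by blast

lemma J_optimal:
  assumes "optimal d g S b z"
  shows "J d g S b = ereal (objective d S b z)"
proof (rule antisym)
  show "J d g S b \<le> ereal (objective d S b z)"
    using assms by (intro J_le optimal_feasible)
  show "ereal (objective d S b z) \<le> J d g S b"
    unfolding J_def using assms
    by (intro INF_greatest) (auto simp: optimal_def is_arg_min_linorder)
qed

lemma objective_cong:
  "(\<And>l. l \<in> S \<Longrightarrow> b l = b' l) \<Longrightarrow> objective d S b z = objective d S b' z"
  unfolding objective_def by (auto split: prod.splits intro!: sum.cong)

lemma J_cong: "(\<And>l. l \<in> S \<Longrightarrow> b l = b' l) \<Longrightarrow> J d g S b = J d g S b'"
  unfolding J_def using objective_cong[of S b b' d] by simp

text \<open>Attainment, built into \<open>bid_profile\<close>, excludes both infinite values once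
  the problem is feasible. This licenses the passage from \<open>ereal\<close> to real
  arithmetic.\<close>

lemma J_finite:
  assumes "bid_profile d g N b" "S \<subseteq> N" "feasible g S \<noteq> {}"
  shows "J d g S b = ereal (real_of_ereal (J d g S b))"
  using assms J_optimal unfolding bid_profile_def by (metis real_of_ereal.simps(1))

lemma solution_optimal:
  assumes "bid_profile d g N b" "feasible g N \<noteq> {}" "solution_rule d g sol"
  shows "optimal d g N b (sol N b)"
  using assms unfolding bid_profile_def solution_rule_def by blast

lemma objective_diff:
  assumes "finite S" "K \<subseteq> S"
  shows "objective d S b z = (\<Sum>l\<in>K. b l (fst z l)) + objective d (S - K) b z"
  using sum.subset_diff[OF assms(2,1), of "\<lambda>l. b l (fst z l)"]
  by (auto simp: objective_def split: prod.splits)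

text \<open>An optimum that gives nothing to \<open>K\<close> stays feasible after \<open>K\<close>
  is removed, and since bids vanish at 0 the two objectives agree wherever \<open>K\<close> supplies
  nothing. The nonemptiness is what later makes the values without \<open>K\<close> finite.\<close>

lemma J_drop_losers:
  assumes "finite N" "K \<subseteq> N" "\<forall>l\<in>K. valid_bid (b l)"
    and opt: "optimal d g N b z" and lose: "\<forall>l\<in>K. fst z l = 0"
  shows "feasible g (N - K) \<noteq> {}" "J d g (N - K) b = J d g N b"
proof -
  have bid0: "b l 0 = 0" if "l \<in> K" for l
    using assms(3) that by (auto simp: valid_bid_def)
  have zf: "z \<in> feasible g (N - K)"
    using optimal_feasible[OF opt] lose by (auto simp: feasible_def allocations_def)
  then show "feasible g (N - K) \<noteq> {}" by blast
  have restrict: "objective d N b w = objective d (N - K) b w" if "w \<in> feasible g (N - K)" for w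
  proof -
    have "(\<Sum>l\<in>K. b l (fst w l)) = 0"
      using that bid0 by (intro sum.neutral) (auto simp: feasible_def allocations_def)
    then show ?thesis using objective_diff[OF assms(1,2), of d b w] by simp
  qed
  show "J d g (N - K) b = J d g N b"
  proof (rule antisym)
    show "J d g (N - K) b \<le> J d g N b"
      using J_le[OF zf] restrict[OF zf] J_optimal[OF opt] by metis
    show "J d g N b \<le> J d g (N - K) b"
      unfolding J_def[of d g "N - K"]
      using restrict feasible_mono[of "N - K" N g] by (intro INF_greatest) (metis J_le Diff_subset subsetD)
  qed
qed

section \<open>Marginal contributions and total payment of a coalition\<close>

lemma supermodular_sum_marginals_le:
  fixes f :: "'i set \<Rightarrow> real"
  assumes "finite K" "K \<subseteq> N"
    and "\<And>A B. N - K \<subseteq> A \<Longrightarrow> A \<subseteq> N \<Longrightarrow> N - K \<subseteq> B \<Longrightarrow> B \<subseteq> N \<Longrightarrow>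
      f A + f B \<le> f (A \<union> B) + f (A \<inter> B)"
  shows "(\<Sum>k\<in>K. f (N - {k}) - f N) \<le> f (N - K) - f N"
  using assms
proof (induction K)
  case (insert k K)
  \<comment> \<open>Removing \<open>k\<close> from \<open>N\<close> costs at most as much as
    removing it after \<open>K\<close> is gone; adding such bounds one bidder at a time
    telescopes.\<close>
  have "f (N - K) + f (N - {k}) \<le> f ((N - K) \<union> (N - {k})) + f ((N - K) \<inter> (N - {k}))"
    by (rule insert.prems(2)) auto
  moreover have "(N - K) \<union> (N - {k}) = N" "(N - K) \<inter> (N - {k}) = N - insert k K"
    using insert.hyps by auto
  moreover have "(\<Sum>k\<in>K. f (N - {k}) - f N) \<le> f (N - K) - f N"
  proof (rule insert.IH)
    \<comment> \<open>The sets between \<open>N - K\<close> and \<open>N\<close> also lie above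
      \<open>N - insert k K\<close>, so the smaller coalition inherits the hypothesis.\<close>
    fix A B assume "N - K \<subseteq> A" "A \<subseteq> N" "N - K \<subseteq> B" "B \<subseteq> N"
    then show "f A + f B \<le> f (A \<union> B) + f (A \<inter> B)"
      by (intro insert.prems(2)) auto
  qed (use insert.prems in auto)
  ultimately show ?case using insert.hyps by simp
qed simp

text \<open>Feasibility without \<open>K\<close> carries over to every set between
  \<open>N - K\<close> and \<open>N\<close>. All values there are finite, so
  \<open>real_of_ereal\<close> loses nothing and supermodularity becomes a real inequality.\<close>

lemma sum_payment_le:
  assumes "finite K" "K \<subseteq> N" "bid_profile d g N b" "J_supermodular d g N"
    and feas: "feasible g (N - K) \<noteq> {}"
  shows "(\<Sum>k\<in>K. payment d g sol N b k)
      \<le> ereal ((\<Sum>k\<in>K. b k (allocation sol N b k))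
          + real_of_ereal (J d g (N - K) b) - real_of_ereal (J d g N b))"
proof -
  define f where "f A = real_of_ereal (J d g A b)" for A
  have J: "J d g A b = ereal (f A)" if "N - K \<subseteq> A" "A \<subseteq> N" for A
    unfolding f_def using that feas feasible_mono[OF that(1), of g]
    by (intro J_finite[OF assms(3)]) auto
  have "(\<Sum>k\<in>K. f (N - {k}) - f N) \<le> f (N - K) - f N"
  proof (rule supermodular_sum_marginals_le[OF assms(1,2)])
    fix A B assume AB: "N - K \<subseteq> A" "A \<subseteq> N" "N - K \<subseteq> B" "B \<subseteq> N"
    then have "J d g A b + J d g B b \<le> J d g (A \<union> B) b + J d g (A \<inter> B) b"
      using assms(3,4) unfolding J_supermodular_def by blast
    moreover have "J d g A b = ereal (f A)" "J d g B b = ereal (f B)"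
      "J d g (A \<union> B) b = ereal (f (A \<union> B))" "J d g (A \<inter> B) b = ereal (f (A \<inter> B))"
      using AB by (auto intro!: J)
    ultimately show "f A + f B \<le> f (A \<union> B) + f (A \<inter> B)" by simp
  qed
  then have "(\<Sum>k\<in>K. b k (allocation sol N b k) + f (N - {k}) - f N)
      \<le> (\<Sum>k\<in>K. b k (allocation sol N b k)) + f (N - K) - f N"
    by (simp add: add_diff_eq[symmetric] sum.distrib)
  moreover have "payment d g sol N b k = ereal (b k (allocation sol N b k) + f (N - {k}) - f N)"
    if "k \<in> K" for k
  proof -
    have "J d g (N - {k}) b = ereal (f (N - {k}))" "J d g N b = ereal (f N)"
      using that by (auto intro!: J)
    then show ?thesis unfolding payment_def by simp
  qed
  ultimately show ?thesis by (simp add: f_def)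
qed

section \<open>Utilities of losing and of truthful bidders\<close>

lemma utility_loser:
  assumes "finite N" "l \<in> N" "valid_bid (b l)" "valid_bid (c l)"
    and "optimal d g N b (sol N b)" "allocation sol N b l = 0"
  shows "utility d g sol N c b l = 0"
proof -
  have "J d g (N - {l}) b = J d g N b"
    using assms by (intro J_drop_losers(2)) (auto simp: allocation_def)
  \<comment> \<open>\<open>J_optimal\<close> supplies finiteness: without it the difference of the
    two equal values could be \<infinity> - \<infinity>, which is not 0 in
    \<open>ereal\<close>.\<close>
  then show ?thesis
    using assms(3-6) J_optimal[OF assms(5)]
    by (simp add: utility_def payment_def valid_bid_def zero_ereal_def)
qed

text \<open>Bid and cost cancel because they are the same real number, even when the optimal values
  are infinite.\<close>

lemma utility_truthful:
  assumes "b l = c l"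
  shows "utility d g sol N c b l = J d g (N - {l}) b - J d g N b"
  unfolding utility_def payment_def assms
  by (cases "J d g (N - {l}) b"; cases "J d g N b") auto

section \<open>Joint deviations of losing bidders\<close>

lemma no_profitable_joint_deviation:
  assumes "finite N" "K \<subseteq> N" "J_supermodular d g N" "solution_rule d g sol"
    and fN: "feasible g N \<noteq> {}"
    and C: "bid_profile d g N C" and B: "bid_profile d g N B"
    and CK: "\<forall>l\<in>K. C l = c l" and BC: "\<forall>l\<in>N - K. B l = C l"
    and lose: "\<forall>l\<in>K. allocation sol N C l = 0"
  shows "(\<Sum>l\<in>K. utility d g sol N c B l) \<le> 0"
proof -
  define x where "x = fst (sol N B)"
  have optC: "optimal d g N C (sol N C)" and optB: "optimal d g N B (sol N B)"
    using solution_optimal fN C B assms(4) by blast+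
  have valC: "\<forall>l\<in>K. valid_bid (C l)"
    using C assms(2) unfolding bid_profile_def by auto
  have loseC: "\<forall>l\<in>K. fst (sol N C) l = 0"
    using lose unfolding allocation_def .
  note drop = J_drop_losers[OF assms(1,2) valC optC loseC]
  \<comment> \<open>The value without \<open>K\<close> ignores the deviation, and since
    \<open>K\<close> loses under \<open>C\<close> it is the full optimum for
    \<open>C\<close>.\<close>
  have JB: "J d g (N - K) B = J d g N C"
    using BC drop(2) J_cong[of "N - K" B C d g] by auto
  \<comment> \<open>Feasibility does not depend on bids, so the outcome under \<open>B\<close>
    competes under \<open>C\<close>. The two objectives differ only in the terms of
    \<open>K\<close>; the rest cancels in \<open>dev\<close>.\<close>
  have "J d g N C \<le> ereal (objective d N C (sol N B))"
    by (rule J_le[OF optimal_feasible[OF optB]])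
  moreover have "objective d N C (sol N B)
      = (\<Sum>l\<in>K. c l (x l)) + objective d (N - K) B (sol N B)"
    using objective_diff[OF assms(1,2), of d C] CK BC
      objective_cong[of "N - K" B C d] by (simp add: x_def)
  moreover have "objective d N B (sol N B)
      = (\<Sum>l\<in>K. B l (x l)) + objective d (N - K) B (sol N B)"
    using objective_diff[OF assms(1,2), of d B] by (simp add: x_def)
  ultimately have dev: "real_of_ereal (J d g (N - K) B) - real_of_ereal (J d g N B)
      \<le> (\<Sum>l\<in>K. c l (x l)) - (\<Sum>l\<in>K. B l (x l))"
    using J_optimal[OF optC] J_optimal[OF optB] by (simp add: JB)
  \<comment> \<open>The costs are real, so adding their negatives lets them be split off from a sum
    of extended reals.\<close>
  have "(\<Sum>l\<in>K. utility d g sol N c B l)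
      = (\<Sum>l\<in>K. payment d g sol N B l) + (\<Sum>l\<in>K. - ereal (c l (x l)))"
    unfolding utility_def allocation_def x_def minus_ereal_def by (rule sum.distrib)
  also have "\<dots> = (\<Sum>l\<in>K. payment d g sol N B l) - ereal (\<Sum>l\<in>K. c l (x l))"
    by (simp add: minus_ereal_def sum_negf)
  also have "\<dots> \<le> ereal ((\<Sum>l\<in>K. B l (x l)) + real_of_ereal (J d g (N - K) B)
      - real_of_ereal (J d g N B)) - ereal (\<Sum>l\<in>K. c l (x l))"
    using sum_payment_le[OF finite_subset[OF assms(2,1)] assms(2) B assms(3) drop(1), of sol]
    by (intro ereal_minus_mono) (auto simp: x_def allocation_def)
  also have "\<dots> \<le> 0" using dev by simp
  finally show ?thesis .
qed

section \<open>Shill bids\<close>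

lemma merge_identities:
  assumes "finite L" "finite S" "l \<in> L" "S \<inter> (L - {l}) = {}"
    and "fungible d" "fungible g"
    and z: "(x, y) \<in> feasible g ((L - {l}) \<union> S)"
  defines "x' \<equiv> \<lambda>k. if k = l then \<Sum>k\<in>S. x k else if k \<in> L then x k else 0"
  shows "(x', y) \<in> feasible g L" "d x' y = d x y"
proof -
  have x: "x \<in> allocations ((L - {l}) \<union> S)" "g x y \<le> 0"
    using z by (auto simp: feasible_def)
  then have nn: "0 \<le> x k" for k by (auto simp: allocations_def)
  \<comment> \<open>\<open>x'\<close> hands the goods of all identities to \<open>l\<close>. The
    case \<open>k = l\<close> is tested first because \<open>l\<close> may itself be one of the
    identities in \<open>S\<close>.\<close>
  have x'L: "x' \<in> allocations L"
    using nn assms(3) by (auto simp: x'_def allocations_def intro: sum_nonneg)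
  have x0: "x k = 0" if "k \<notin> (L - {l}) \<union> S" for k
    using x(1) that by (auto simp: allocations_def)
  \<comment> \<open>\<open>fungible\<close> compares allocations over one participant set, so both
    are viewed on \<open>L \<union> S\<close>, extended by zero.\<close>
  have "(\<Sum>k\<in>L \<union> S. x' k) = (\<Sum>k\<in>L. x' k)"
    using assms(1,2) x'L by (intro sum.mono_neutral_right) (auto simp: allocations_def)
  also have "\<dots> = x' l + (\<Sum>k\<in>L - {l}. x' k)"
    using assms(1,3) by (rule sum.remove)
  also have "\<dots> = (\<Sum>k\<in>S. x k) + (\<Sum>k\<in>L - {l}. x k)"
    by (auto simp: x'_def intro!: sum.cong)
  also have "\<dots> = (\<Sum>k\<in>(L - {l}) \<union> S. x k)"
    using assms(1,2,4) by (subst sum.union_disjoint) (auto simp: add.commute)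
  also have "\<dots> = (\<Sum>k\<in>L \<union> S. x k)"
    using assms(1,2) x0 by (intro sum.mono_neutral_left) auto
  finally have sums: "(\<Sum>k\<in>L \<union> S. x' k) = (\<Sum>k\<in>L \<union> S. x k)" .
  have fin: "finite (L \<union> S)" using assms(1,2) by simp
  have "x \<in> allocations (L \<union> S)" "x' \<in> allocations (L \<union> S)"
    using x(1) x'L allocations_mono[of L "L \<union> S"] allocations_mono[of "(L - {l}) \<union> S" "L \<union> S"]
    by auto
  then have d: "d x' y = d x y" and g: "g x' y = g x y"
    using assms(5,6) sums fin unfolding fungible_def by blast+
  show "d x' y = d x y" by (rule d)
  show "(x', y) \<in> feasible g L" using x(2) x'L g by (simp add: feasible_def)
qed

lemma shill_bids_unprofitable:
  assumes "finite L" "l \<in> L" "fungible d" "fungible g"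
    and fL: "feasible g (L - {l}) \<noteq> {}" and sol: "solution_rule d g sol"
    and "finite S" and disj: "S \<inter> (L - {l}) = {}"
  defines "N \<equiv> (L - {l}) \<union> S"
  assumes "J_supermodular d g N"
    and C: "bid_profile d g L C" and B: "bid_profile d g N B"
    and Cl: "C l = c l" and BC: "\<forall>k\<in>L - {l}. B k = C k"
  shows "(\<Sum>k\<in>S. payment d g sol N B k) - ereal (c l (\<Sum>k\<in>S. allocation sol N B k))
    \<le> utility d g sol L c C l"
proof -
  obtain x y where xy: "sol N B = (x, y)" by fastforce
  define x' where "x' = (\<lambda>k. if k = l then \<Sum>k\<in>S. x k else if k \<in> L then x k else 0)"
  have NS: "N - S = L - {l}" and SN: "S \<subseteq> N" and finN: "finite N"
    using assms(1,7) disj by (auto simp: N_def)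
  have "feasible g N \<noteq> {}" "feasible g L \<noteq> {}"
    using fL feasible_mono[of "L - {l}" N g] feasible_mono[of "L - {l}" L g]
    by (auto simp: N_def)
  then have optB: "optimal d g N B (x, y)" and optC: "optimal d g L C (sol L C)"
    using solution_optimal[OF B _ sol] solution_optimal[OF C _ sol] xy by auto
  have fz: "(x, y) \<in> feasible g ((L - {l}) \<union> S)"
    using optimal_feasible[OF optB] by (simp add: N_def)
  note merge = merge_identities[OF assms(1,7,2) disj assms(3,4) fz, folded x'_def]
  have "objective d L C (x', y) = c l (\<Sum>k\<in>S. x k) + (\<Sum>k\<in>L - {l}. C k (x' k)) + d x y"
    using sum.remove[OF assms(1,2), of "\<lambda>k. C k (x' k)"] merge(2) Cl
    by (simp add: objective_def x'_def)
  also have "(\<Sum>k\<in>L - {l}. C k (x' k)) = (\<Sum>k\<in>L - {l}. B k (x k))"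
    using BC by (intro sum.cong) (auto simp: x'_def)
  finally have objC: "objective d L C (x', y)
      = c l (\<Sum>k\<in>S. x k) + (\<Sum>k\<in>L - {l}. B k (x k)) + d x y" .
  have objB: "objective d N B (x, y)
      = (\<Sum>k\<in>S. B k (x k)) + (\<Sum>k\<in>L - {l}. B k (x k)) + d x y"
    using objective_diff[OF finN SN, of d B "(x, y)"] by (simp add: NS objective_def)
  have dev: "real_of_ereal (J d g L C) \<le> real_of_ereal (J d g N B)
      - (\<Sum>k\<in>S. B k (x k)) + c l (\<Sum>k\<in>S. x k)"
    using J_le[OF merge(1), of d C] J_optimal[OF optC] J_optimal[OF optB] objB objC by simp
  have JLl: "J d g (L - {l}) B = J d g (L - {l}) C"
    using BC by (intro J_cong) auto
  have alloc: "allocation sol N B k = x k" for k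
    by (simp add: allocation_def xy)
  have "(\<Sum>k\<in>S. payment d g sol N B k)
      \<le> ereal ((\<Sum>k\<in>S. B k (x k)) + real_of_ereal (J d g (L - {l}) C) - real_of_ereal (J d g N B))"
    using sum_payment_le[OF assms(7) SN B assms(10), of sol] fL by (simp add: NS JLl alloc)
  then have "(\<Sum>k\<in>S. payment d g sol N B k) - ereal (c l (\<Sum>k\<in>S. allocation sol N B k))
      \<le> ereal ((\<Sum>k\<in>S. B k (x k)) + real_of_ereal (J d g (L - {l}) C) - real_of_ereal (J d g N B))
        - ereal (c l (\<Sum>k\<in>S. x k))"
    by (intro ereal_minus_mono) (auto simp: alloc)
  also have "\<dots> \<le> ereal (real_of_ereal (J d g (L - {l}) C)) - ereal (real_of_ereal (J d g L C))"
    using dev by simp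
  also have "\<dots> = utility d g sol L c C l"
    using J_finite[OF C _ fL] J_optimal[OF optC] utility_truthful[of C l c d g sol L, OF Cl] by auto
  finally show ?thesis .
qed

theorem theorem3:
  fixes d :: "('i \<Rightarrow> real^('t::finite)) \<Rightarrow> real^('p::finite) \<Rightarrow> real"
    and g :: "('i \<Rightarrow> real^'t) \<Rightarrow> real^'p \<Rightarrow> real^('q::finite)"
    and sol :: "('i, 't, 'p) solution_rule"
    and L :: "'i set"
    and c :: "'i \<Rightarrow> 't bid"
  assumes "finite L"
    and "fungible d" and "fungible g"
    and "\<forall>l\<in>L. feasible g (L - {l}) \<noteq> {}"
    and "solution_rule d g sol"
    and "\<forall>l\<in>L. valid_bid (c l)"
    and "J_supermodular d g L"
  shows
    "(\<forall>K C B. K \<subseteq> L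
        \<and> bid_profile d g L C \<and> bid_profile d g L B
        \<and> (\<forall>l\<in>K. C l = c l) \<and> (\<forall>l\<in>L - K. B l = C l)
        \<and> (\<forall>l\<in>K. allocation sol L C l = 0)
      \<longrightarrow> (\<Sum>l\<in>K. utility d g sol L c B l) \<le> (\<Sum>l\<in>K. utility d g sol L c C l)
        \<and> (\<Sum>l\<in>K. utility d g sol L c C l) = 0)
    \<and> (\<forall>l\<in>L. \<forall>S C B. finite S \<and> S \<inter> (L - {l}) = {}
        \<and> J_supermodular d g ((L - {l}) \<union> S)
        \<and> bid_profile d g L C \<and> bid_profile d g ((L - {l}) \<union> S) B
        \<and> C l = c l \<and> (\<forall>k\<in>L - {l}. B k = C k)
      \<longrightarrow> (\<Sum>k\<in>S. payment d g sol ((L - {l}) \<union> S) B k)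
            - ereal (c l (\<Sum>k\<in>S. allocation sol ((L - {l}) \<union> S) B k))
          \<le> utility d g sol L c C l)"
proof (intro conjI allI impI ballI; elim conjE)
  fix K C B
  assume K: "K \<subseteq> L" and C: "bid_profile d g L C" and B: "bid_profile d g L B"
    and CK: "\<forall>l\<in>K. C l = c l" and BC: "\<forall>l\<in>L - K. B l = C l"
    and lose: "\<forall>l\<in>K. allocation sol L C l = 0"
  have fL: "feasible g L \<noteq> {}" if "l \<in> K" for l
    using that K assms(4) feasible_mono[of "L - {l}" L g] by auto
  have "utility d g sol L c C l = 0" if "l \<in> K" for l
    using that K CK lose assms(1,6) solution_optimal[OF C fL assms(5)]
    by (intro utility_loser) auto
  then show zero: "(\<Sum>l\<in>K. utility d g sol L c C l) = 0" by simp
  show "(\<Sum>l\<in>K. utility d g sol L c B l) \<le> (\<Sum>l\<in>K. utility d g sol L c C l)"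
  proof (cases "K = {}")
    case False
    then show ?thesis
      using no_profitable_joint_deviation[OF assms(1) K assms(7,5) _ C B CK BC lose] fL zero by auto
  qed simp
next
  fix l S C B
  assume "l \<in> L" "finite S" "S \<inter> (L - {l}) = {}" "J_supermodular d g ((L - {l}) \<union> S)"
    "bid_profile d g L C" "bid_profile d g ((L - {l}) \<union> S) B"
    "C l = c l" "\<forall>k\<in>L - {l}. B k = C k"
  then show "(\<Sum>k\<in>S. payment d g sol ((L - {l}) \<union> S) B k)
      - ereal (c l (\<Sum>k\<in>S. allocation sol ((L - {l}) \<union> S) B k)) \<le> utility d g sol L c C l"
    using assms(1-5) by (intro shill_bids_unprofitable) auto
qed

end
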